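(* Let $G$ be a connected irregular simple graph with $n$ vertices, $m$ edges, maximum degree $\Delta$ and diameter $\operatorname{diam}(G)$, and let $\alpha \in [0,1]$. Then $$\lambda_1(A_\alpha(G)) < \Delta - (1-\alpha)\frac{n\Delta - 2m}{n\left(\operatorname{diam}(G)(n\Delta - 2m) + 1\right)}.$$
   Context: For a simple graph $G$ with adjacency matrix $A(G)$ and diagonal degree matrix $D(G)$, and $\alpha\in[0,1]$, define $A_\alpha(G) = \alpha D(G) + (1-\alpha)A(G)$. Its eigenvalues (real, since it is symmetric) are ordered $\lambda_1(A_\alpha(G)) \ge \lambda_2(A_\alpha(G)) \ge \dots \ge \lambda_n(A_\alpha(G))$. A graph is irregular if its vertex degrees take at least two distinct values. The diameter $\operatorname{diam}(G)$ of a connected graph is the maximum distance between two of its vertices.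
   Formalization: The formal theorem assumes 0 ≤ α < 1 instead of α ∈ [0,1]; at α = 1 the matrix is D(G), so λ₁ = Δ and the right-hand side is also Δ, and the strict inequality fails for every graph. *)

theory Defs
  imports
    "Graph_Theory.Digraph_Component"
    "Jordan_Normal_Form.Char_Poly"
    "HOL-Computational_Algebra.Polynomial"
begin

text \<open>
  Simple graphs are the symmetric, loop-free, finite digraphs without parallel arcs of the
  locale \<^locale>\<open>graph\<close>: an edge \<open>uv\<close> is a pair of opposite arcs.  Hence the edges are the
  unordered pairs of ends of arcs, and the degree of a vertex is its out-degree.
\<close>

definition edges :: "('a, 'b) pre_digraph \<Rightarrow> 'a set set" where
  "edges G = (\<lambda>e. {tail G e, head G e}) ` arcs G"

definition vertex_degree :: "('a, 'b) pre_digraph \<Rightarrow> 'a \<Rightarrow> nat" where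
  "vertex_degree G v = out_degree G v"

definition max_degree :: "('a, 'b) pre_digraph \<Rightarrow> nat" where
  "max_degree G = Max (vertex_degree G ` verts G)"

definition irregular :: "('a, 'b) pre_digraph \<Rightarrow> bool" where
  "irregular G \<longleftrightarrow> (\<exists>u\<in>verts G. \<exists>v\<in>verts G. vertex_degree G u \<noteq> vertex_degree G v)"

definition graph_dist :: "('a, 'b) pre_digraph \<Rightarrow> 'a \<Rightarrow> 'a \<Rightarrow> nat" where
  "graph_dist G u v = (LEAST k. \<exists>p. pre_digraph.awalk G u p v \<and> length p = k)"

definition diam :: "('a, 'b) pre_digraph \<Rightarrow> nat" where
  "diam G = Max {graph_dist G u v | u v. u \<in> verts G \<and> v \<in> verts G}"

text \<open>
  The matrices are taken with respect to a labelling of the vertices, given as a list \<open>vs\<close>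
  that enumerates them without repetition.
\<close>

definition vertex_labelling :: "('a, 'b) pre_digraph \<Rightarrow> 'a list \<Rightarrow> bool" where
  "vertex_labelling G vs \<longleftrightarrow> distinct vs \<and> set vs = verts G"

definition adjacency_mat :: "('a, 'b) pre_digraph \<Rightarrow> 'a list \<Rightarrow> real mat" where
  "adjacency_mat G vs =
     mat (length vs) (length vs) (\<lambda>(i, j). if vs ! i \<rightarrow>\<^bsub>G\<^esub> vs ! j then 1 else 0)"

definition degree_mat :: "('a, 'b) pre_digraph \<Rightarrow> 'a list \<Rightarrow> real mat" where
  "degree_mat G vs =
     mat (length vs) (length vs) (\<lambda>(i, j). if i = j then real (vertex_degree G (vs ! i)) else 0)"

definition A_alpha :: "real \<Rightarrow> ('a, 'b) pre_digraph \<Rightarrow> 'a list \<Rightarrow> real mat" where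
  "A_alpha \<alpha> G vs = \<alpha> \<cdot>\<^sub>m degree_mat G vs + (1 - \<alpha>) \<cdot>\<^sub>m adjacency_mat G vs"

text \<open>
  The real eigenvalues with multiplicity, in decreasing order.  For a symmetric matrix these are
  all its eigenvalues.  The index \<open>k\<close> of \<open>nth_eigenvalue\<close> starts at 1.
\<close>

definition eigenvalues_desc :: "real mat \<Rightarrow> real list" where
  "eigenvalues_desc A = rev (sorted_list_of_multiset (proots (char_poly A)))"

definition nth_eigenvalue :: "nat \<Rightarrow> real mat \<Rightarrow> real" where
  "nth_eigenvalue k A = eigenvalues_desc A ! (k - 1)"

end

theory Submission
  imports Defs "Jordan_Normal_Form.Spectral_Radius" "HOL-Analysis.Convex"
begin

text \<open>
  For an eigenvector \<open>x\<close> to the eigenvalue \<open>\<lambda>\<close> one has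
  \<open>(\<Delta> - \<lambda>) \<Sum>x\<^sub>v\<^sup>2 = \<Sum>(\<Delta> - d\<^sub>v) x\<^sub>v\<^sup>2 + (1 - \<alpha>) \<Sum>\<^bsub>uv\<in>E\<^esub> (x\<^sub>u - x\<^sub>v)\<^sup>2\<close>.
  Let \<open>u\<close> maximise \<open>|x\<^sub>u|\<close>, and let \<open>v\<close> minimise \<open>|x\<^sub>v|\<close> among the vertices with \<open>d\<^sub>v < \<Delta>\<close>.
  With \<open>c = n\<Delta> - 2m = \<Sum>(\<Delta> - d\<^sub>v)\<close>, the first sum is at least \<open>c x\<^sub>v\<^sup>2\<close>, and Cauchy--Schwarz along
  a shortest path from \<open>u\<close> to \<open>v\<close> bounds the second one from below by \<open>(x\<^sub>u - x\<^sub>v)\<^sup>2 / diam G\<close>.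
  Minimising \<open>c t\<^sup>2 + (x\<^sub>u - t)\<^sup>2 / diam G\<close> over \<open>t\<close> gives \<open>c x\<^sub>u\<^sup>2 / (c diam G + 1)\<close>, and
  \<open>x\<^sub>u\<^sup>2 \<ge> \<Sum>x\<^sub>v\<^sup>2 / n\<close>.  The last inequality is strict unless \<open>|x|\<close> is constant, in which case
  \<open>c x\<^sub>v\<^sup>2 = c x\<^sub>u\<^sup>2\<close> is already too large.  No positivity of \<open>x\<close> is needed, so the bound holds for
  every eigenvalue.
\<close>

section \<open>Eigenvalues of real symmetric matrices\<close>

text \<open>For an eigenvector \<open>v\<close>, the form \<open>q\<close> of \<open>A\<close> at
  \<open>v\<close> equals \<open>k\<close> times the squared norm \<open>N > 0\<close>. As
  \<open>A\<close> is real and symmetric, \<open>q\<close> is its own conjugate, so \<open>k\<close>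
  is real.\<close>

lemma symmetric_mat_complex_eigenvalue_real:
  fixes A :: "real mat"
  assumes A: "A \<in> carrier_mat n n"
    and sym: "\<And>i j. i < n \<Longrightarrow> j < n \<Longrightarrow> A $$ (i, j) = A $$ (j, i)"
    and ev: "eigenvalue (map_mat complex_of_real A) k"
  shows "k = complex_of_real (Re k)"
proof -
  from ev A obtain v where v: "v \<in> carrier_vec n" "v \<noteq> 0\<^sub>v n"
    and eq: "map_mat complex_of_real A *\<^sub>v v = k \<cdot>\<^sub>v v"
    unfolding eigenvalue_def eigenvector_def by auto
  have row: "(\<Sum>j<n. complex_of_real (A $$ (i, j)) * v $ j) = k * v $ i" if "i < n" for i
  proof -
    have "(map_mat complex_of_real A *\<^sub>v v) $ i = (\<Sum>j<n. complex_of_real (A $$ (i, j)) * v $ j)"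
      using that A v by (simp add: scalar_prod_def atLeast0LessThan)
    then show ?thesis using eq that v by simp
  qed
  define q where "q = (\<Sum>i<n. \<Sum>j<n. complex_of_real (A $$ (i, j)) * (cnj (v $ i) * v $ j))"
  define N where "N = (\<Sum>i<n. (cmod (v $ i))\<^sup>2)"
  have "q = (\<Sum>i<n. cnj (v $ i) * (k * v $ i))"
    unfolding q_def by (intro sum.cong) (simp_all flip: row add: sum_distrib_left ac_simps)
  also have "\<dots> = k * complex_of_real N"
    unfolding N_def of_real_sum sum_distrib_left
    by (intro sum.cong) (simp_all only: complex_norm_square ac_simps)
  finally have q: "q = k * complex_of_real N" .
  have "cnj q = (\<Sum>i<n. \<Sum>j<n. complex_of_real (A $$ (i, j)) * (cnj (v $ j) * v $ i))"
    unfolding q_def by (simp add: ac_simps)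
  also have "\<dots> = (\<Sum>j<n. \<Sum>i<n. complex_of_real (A $$ (i, j)) * (cnj (v $ j) * v $ i))"
    by (rule sum.swap)
  also have "\<dots> = q"
    unfolding q_def by (intro sum.cong refl) (simp add: sym)
  finally have "Im q = 0"
    by (simp add: complex_eq_iff)
  moreover have "N > 0"
  proof -
    obtain i where "i < n" "v $ i \<noteq> 0"
      using v by (metis carrier_vecD eq_vecI index_zero_vec(1) index_zero_vec(2))
    then show ?thesis unfolding N_def by (intro sum_pos2[of _ i]) auto
  qed
  ultimately have "Im k = 0" using q by simp
  then show ?thesis by (simp add: complex_eq_iff)
qed

text \<open>Over the complex numbers the spectrum is nonempty. Such an eigenvalue is real, so its
  real part is already a root of the real characteristic polynomial.\<close>

lemma symmetric_mat_eigenvalue_exists: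
  fixes A :: "real mat"
  assumes A: "A \<in> carrier_mat n n" and "n > 0"
    and sym: "\<And>i j. i < n \<Longrightarrow> j < n \<Longrightarrow> A $$ (i, j) = A $$ (j, i)"
  shows "\<exists>k. eigenvalue A k"
proof -
  let ?C = "map_mat complex_of_real A"
  have C: "?C \<in> carrier_mat n n" using A by simp
  obtain k where k: "eigenvalue ?C k"
    using spectrum_non_empty[OF C \<open>n > 0\<close>] unfolding spectrum_def by auto
  have "poly (map_poly complex_of_real (char_poly A)) (complex_of_real (Re k)) = 0"
    using k symmetric_mat_complex_eigenvalue_real[OF A sym k] eigenvalue_root_char_poly[OF C]
    by (simp add: of_real_hom.char_poly_hom[OF A])
  then have "poly (char_poly A) (Re k) = 0" by simp
  then show ?thesis using eigenvalue_root_char_poly[OF A] by blast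
qed

text \<open>\<open>proots\<close> of a nonzero polynomial holds exactly its roots, so every list
  entry is an eigenvalue. The given \<open>k\<close> makes the list nonempty, so that its entry 0 is
  meaningful.\<close>

lemma eigenvalue_nth_eigenvalue_1:
  fixes A :: "real mat"
  assumes A: "A \<in> carrier_mat n n" and "eigenvalue A k"
  shows "eigenvalue A (nth_eigenvalue 1 A)"
proof -
  let ?l = "eigenvalues_desc A"
  have "char_poly A \<noteq> 0" using degree_monic_char_poly[OF A] by auto
  then have set: "set ?l = {k. eigenvalue A k}"
    unfolding eigenvalues_desc_def using eigenvalue_root_char_poly[OF A] by simp
  then have "?l \<noteq> []" using assms(2) by auto
  then have "?l ! 0 \<in> set ?l" by simp
  then show ?thesis using set unfolding nth_eigenvalue_def by simp
qed

section \<open>Sums over arcs and edges\<close>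

lemma (in graph) finite_edges: "finite (edges G)"
  unfolding edges_def by simp

text \<open>Each edge comes from exactly two arcs: symmetry supplies the opposite arc, the absence
  of loops makes it different, and the absence of parallel arcs excludes a third.\<close>

lemma (in graph) sum_arcs_eq_sum_edges:
  fixes g :: "'a set \<Rightarrow> real"
  shows "(\<Sum>e\<in>arcs G. g {tail G e, head G e}) = 2 * (\<Sum>s\<in>edges G. g s)"
proof -
  let ?h = "\<lambda>e. {tail G e, head G e}"
  have "card {e \<in> arcs G. ?h e = s} = 2" if "s \<in> edges G" for s
  proof -
    from that obtain e where e: "e \<in> arcs G" "s = ?h e" unfolding edges_def by auto
    obtain e' where e': "e' \<in> arcs G" "tail G e' = head G e" "head G e' = tail G e"
      using sym_arcs e(1) unfolding symmetric_conv by metis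
    have "{e \<in> arcs G. ?h e = s} = {e, e'}"
      using e e' no_multi_arcs by (auto simp: doubleton_eq_iff arc_to_ends_def)
    moreover have "e \<noteq> e'" using no_loops e(1) e'(2) by metis
    ultimately show ?thesis by simp
  qed
  moreover have "(\<Sum>e\<in>arcs G. g (?h e)) = (\<Sum>s\<in>edges G. \<Sum>e\<in>{e \<in> arcs G. ?h e = s}. g (?h e))"
    unfolding edges_def by (rule sum.image_gen) simp
  ultimately show ?thesis by (simp add: sum_distrib_left)
qed

lemma (in graph) sum_arcs_tail:
  fixes f :: "'a \<Rightarrow> real"
  shows "(\<Sum>e\<in>arcs G. f (tail G e)) = (\<Sum>v\<in>verts G. real (vertex_degree G v) * f v)"
proof -
  have "(\<Sum>e\<in>arcs G. f (tail G e)) = (\<Sum>v\<in>verts G. \<Sum>e\<in>{e \<in> arcs G. tail G e = v}. f (tail G e))"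
    by (rule sum.group[symmetric]) auto
  also have "\<dots> = (\<Sum>v\<in>verts G. real (vertex_degree G v) * f v)"
    by (intro sum.cong) (auto simp: vertex_degree_def out_degree_def out_arcs_def)
  finally show ?thesis .
qed

text \<open>Without parallel arcs, arcs correspond to ordered adjacent pairs. This links arc sums to
  the double sums given by matrix entries.\<close>

lemma (in graph) sum_arcs_eq_sum_adjacent:
  fixes F :: "'a \<Rightarrow> 'a \<Rightarrow> real"
  shows "(\<Sum>e\<in>arcs G. F (tail G e) (head G e)) =
    (\<Sum>u\<in>verts G. \<Sum>v\<in>verts G. if u \<rightarrow>\<^bsub>G\<^esub> v then F u v else 0)"
proof -
  have inj: "inj_on (arc_to_ends G) (arcs G)"
    using no_multi_arcs by (auto intro: inj_onI)
  have "(\<Sum>u\<in>verts G. \<Sum>v\<in>verts G. if u \<rightarrow>\<^bsub>G\<^esub> v then F u v else 0) =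
      (\<Sum>p\<in>verts G \<times> verts G. if p \<in> arcs_ends G then F (fst p) (snd p) else 0)"
    by (simp add: sum.cartesian_product case_prod_unfold)
  also have "\<dots> = (\<Sum>p\<in>arcs_ends G. F (fst p) (snd p))"
    by (rule sum.mono_neutral_cong_right) (auto simp: arcs_ends_conv)
  also have "\<dots> = (\<Sum>e\<in>arcs G. F (tail G e) (head G e))"
    unfolding arcs_ends_def by (subst sum.reindex[OF inj]) (simp add: arc_to_ends_def)
  finally show ?thesis ..
qed

lemma (in graph) sum_arcs_head:
  fixes f :: "'a \<Rightarrow> real"
  shows "(\<Sum>e\<in>arcs G. f (head G e)) = (\<Sum>e\<in>arcs G. f (tail G e))"
proof -
  have "(\<Sum>e\<in>arcs G. f (head G e)) = (\<Sum>u\<in>verts G. \<Sum>v\<in>verts G. if u \<rightarrow>\<^bsub>G\<^esub> v then f v else 0)"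
    by (rule sum_arcs_eq_sum_adjacent)
  also have "\<dots> = (\<Sum>v\<in>verts G. \<Sum>u\<in>verts G. if u \<rightarrow>\<^bsub>G\<^esub> v then f v else 0)"
    by (rule sum.swap)
  also have "\<dots> = (\<Sum>v\<in>verts G. \<Sum>u\<in>verts G. if v \<rightarrow>\<^bsub>G\<^esub> u then f v else 0)"
    by (intro sum.cong refl if_cong) (meson sym_arcs symmetric_def symD)
  also have "\<dots> = (\<Sum>e\<in>arcs G. f (tail G e))"
    by (rule sum_arcs_eq_sum_adjacent[symmetric])
  finally show ?thesis .
qed

text \<open>The handshake lemma: arcs are counted once by tails and once by edges.\<close>

lemma (in graph) sum_vertex_degree:
  "(\<Sum>v\<in>verts G. real (vertex_degree G v)) = 2 * real (card (edges G))"
  using sum_arcs_tail[of "\<lambda>_. 1"] sum_arcs_eq_sum_edges[of "\<lambda>_. 1"] by simp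

section \<open>The Dirichlet energy\<close>

text \<open>The difference of maximum and minimum makes \<open>(x\<^sub>u - x\<^sub>v)\<^sup>2\<close> a function of the set \<open>{u, v}\<close>.\<close>

definition dirichlet_energy :: "('a, 'b) pre_digraph \<Rightarrow> ('a \<Rightarrow> real) \<Rightarrow> real" where
  "dirichlet_energy G x = (\<Sum>s\<in>edges G. (Max (x ` s) - Min (x ` s))\<^sup>2)"

lemma Max_minus_Min_doubleton_square:
  fixes x :: "'a \<Rightarrow> real"
  shows "(Max (x ` {u, v}) - Min (x ` {u, v}))\<^sup>2 = (x u - x v)\<^sup>2"
  by (simp add: max_def min_def power2_commute)

lemma dirichlet_energy_nonneg: "0 \<le> dirichlet_energy G x"
  unfolding dirichlet_energy_def by (simp add: sum_nonneg)

text \<open>The energy is the quadratic form of the Laplacian, the degree matrix minus the adjacency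
  matrix.\<close>

lemma (in graph) dirichlet_energy_eq:
  "dirichlet_energy G x =
    (\<Sum>v\<in>verts G. real (vertex_degree G v) * (x v)\<^sup>2) - (\<Sum>e\<in>arcs G. x (tail G e) * x (head G e))"
proof -
  have "2 * dirichlet_energy G x = (\<Sum>e\<in>arcs G. (x (tail G e) - x (head G e))\<^sup>2)"
    unfolding dirichlet_energy_def sum_arcs_eq_sum_edges[symmetric] Max_minus_Min_doubleton_square ..
  also have "\<dots> = (\<Sum>e\<in>arcs G. (x (tail G e))\<^sup>2) + (\<Sum>e\<in>arcs G. (x (head G e))\<^sup>2)
      - 2 * (\<Sum>e\<in>arcs G. x (tail G e) * x (head G e))"
    by (simp add: power2_diff sum.distrib sum_subtractf sum_distrib_left mult.assoc)
  finally show ?thesis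
    using sum_arcs_head[of "\<lambda>v. (x v)\<^sup>2"] sum_arcs_tail[of "\<lambda>v. (x v)\<^sup>2"] by simp
qed

text \<open>An arc and its reverse give the same edge, so a walk could count an edge twice. On a
  path the tail of the first arc is never visited again, whereas both ends of every later arc are
  visited.\<close>

lemma (in graph) apath_inj_on_edges:
  assumes "apath u p v"
  shows "inj_on (\<lambda>e. {tail G e, head G e}) (set p)"
  using assms
proof (induction p arbitrary: u)
  case (Cons e p)
  then have p: "apath (head G e) p v" and e: "tail G e \<notin> set (awalk_verts (head G e) p)"
    unfolding apath_Cons_iff by blast+
  have "awalk (head G e) p v" using p by (simp add: apath_def)
  then have "{tail G f, head G f} \<subseteq> set (awalk_verts (head G e) p)" if "f \<in> set p" for f
    using that awalk_verts_arc1 awalk_verts_arc2 by (metis awalkE empty_subsetI insert_subset)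
  with e Cons.IH[OF p] show ?case
    by (auto simp: doubleton_eq_iff)
qed simp

text \<open>The differences along the path telescope to \<open>x u - x v\<close>. Cauchy-Schwarz
  bounds the square, and injectivity on edges turns the sum over arcs into part of the
  energy.\<close>

lemma (in graph) apath_energy_bound:
  assumes "apath u p v"
  shows "(x u - x v)\<^sup>2 \<le> real (length p) * dirichlet_energy G x"
proof -
  let ?d = "\<lambda>e. x (tail G e) - x (head G e)" and ?h = "\<lambda>e. {tail G e, head G e}"
  have walk: "awalk u p v" and dist: "distinct p"
    using assms distinct_verts_imp_distinct by (auto simp: apath_def)
  have "cas u p v \<Longrightarrow> (\<Sum>e\<leftarrow>p. ?d e) = x u - x v"
    by (induction p arbitrary: u) auto
  then have "x u - x v = (\<Sum>e\<in>set p. ?d e)"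
    using walk dist by (simp add: awalk_def sum_list_distinct_conv_sum_set)
  then have "(x u - x v)\<^sup>2 \<le> real (length p) * (\<Sum>e\<in>set p. (?d e)\<^sup>2)"
    using sum_squared_le_sum_of_squares[of ?d "set p"] dist
    by (simp add: distinct_card mult.commute)
  also have "(\<Sum>e\<in>set p. (?d e)\<^sup>2) = (\<Sum>s\<in>?h ` set p. (Max (x ` s) - Min (x ` s))\<^sup>2)"
    unfolding sum.reindex[OF apath_inj_on_edges[OF assms]] comp_def Max_minus_Min_doubleton_square ..
  also have "\<dots> \<le> dirichlet_energy G x"
    unfolding dirichlet_energy_def
    using walk by (intro sum_mono2 finite_edges) (auto simp: awalk_def edges_def)
  finally show ?thesis by (simp add: mult_left_mono)
qed

lemma (in graph) graph_dist_apath: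
  assumes "Digraph_Component.connected G" "u \<in> verts G" "v \<in> verts G"
  obtains p where "apath u p v" "length p = graph_dist G u v"
proof -
  \<comment> \<open>Connectedness refers to the symmetric closure, which has the same reachability
    as the symmetric \<open>G\<close>.\<close>
  have "u \<rightarrow>\<^sup>* v"
    using assms unfolding Digraph_Component.connected_def
    by (auto simp: reachable_mk_symmetric_eq[OF sym_arcs])
  then have "\<exists>k p. awalk u p v \<and> length p = k" by (simp add: reachable_awalk)
  then obtain p where p: "awalk u p v" "length p = graph_dist G u v"
    unfolding graph_dist_def
    using LeastI_ex[of "\<lambda>k. \<exists>p. awalk u p v \<and> length p = k"] by blast
  \<comment> \<open>A repeated vertex would enclose a nonempty closed subwalk \<open>r\<close>, and
    cutting it out would give a shorter walk.\<close>
  have "distinct (awalk_verts u p)"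
  proof (rule ccontr)
    assume "\<not> distinct (awalk_verts u p)"
    then obtain q r s w where "p = q @ r @ s" "0 < length r" "awalk u q w" "awalk w s v"
      using awalk_not_distinct_decomp[OF p(1)] by blast
    then have "awalk u (q @ s) v" "length (q @ s) < graph_dist G u v"
      by (auto simp flip: p(2))
    then show False unfolding graph_dist_def
      using not_less_Least[of "length (q @ s)" "\<lambda>k. \<exists>p. awalk u p v \<and> length p = k"] by blast
  qed
  with p show ?thesis using that by (simp add: apath_def)
qed

lemma (in graph) graph_dist_le_diam:
  assumes "u \<in> verts G" "v \<in> verts G"
  shows "graph_dist G u v \<le> diam G"
  unfolding diam_def using assms
  by (intro Max_ge) (auto intro: finite_image_set2[of "\<lambda>u. u \<in> verts G" "\<lambda>v. v \<in> verts G"])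

lemma (in graph) diam_energy_bound:
  assumes "Digraph_Component.connected G" "u \<in> verts G" "v \<in> verts G"
  shows "(x u - x v)\<^sup>2 \<le> real (diam G) * dirichlet_energy G x"
proof -
  obtain p where "apath u p v" "length p \<le> diam G"
    using graph_dist_apath[OF assms] graph_dist_le_diam[OF assms(2,3)] by metis
  then show ?thesis
    using apath_energy_bound[of u p v x] dirichlet_energy_nonneg[of G x]
    by (meson mult_right_mono of_nat_mono order_trans)
qed

section \<open>The lower bound for the quadratic form\<close>

lemma quadratic_tradeoff:
  fixes a t c D S :: real
  assumes "c > 0" "D > 0" and S: "(a - t)\<^sup>2 \<le> D * S"
  shows "c * a\<^sup>2 \<le> (D * c + 1) * (c * t\<^sup>2 + S)"
proof -
  \<comment> \<open>\<open>s\<close> is the slope for which \<open>a - t\<close> is covered in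
    \<open>D\<close> equal steps. The minimum over \<open>t\<close> lies at
    \<open>c * t = s\<close>, so the slack is a multiple of the square of
    \<open>c * t - s\<close>.\<close>
  define s where "s = (a - t) / D"
  have a: "a = t + s * D" using \<open>D > 0\<close> by (simp add: s_def)
  have "D * (s\<^sup>2 * D) \<le> D * S" using S by (simp add: a power2_eq_square ac_simps)
  then have "s\<^sup>2 * D \<le> S" using \<open>D > 0\<close> by simp
  then have "(D * c + 1) * (c * t\<^sup>2 + s\<^sup>2 * D) \<le> (D * c + 1) * (c * t\<^sup>2 + S)"
    using assms by (intro mult_left_mono) auto
  moreover have "(D * c + 1) * (c * t\<^sup>2 + s\<^sup>2 * D) - c * a\<^sup>2 = D * (c * t - s)\<^sup>2"
    unfolding a by (simp add: power2_eq_square algebra_simps)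
  moreover have "0 \<le> D * (c * t - s)\<^sup>2" using \<open>D > 0\<close> by simp
  ultimately show ?thesis by linarith
qed

lemma (in graph) vertex_degree_le_max_degree:
  "v \<in> verts G \<Longrightarrow> vertex_degree G v \<le> max_degree G"
  unfolding max_degree_def by (intro Max_ge) auto

lemma (in graph) deficiency_eq_sum:
  "real (card (verts G)) * real (max_degree G) - 2 * real (card (edges G)) =
    (\<Sum>v\<in>verts G. real (max_degree G) - real (vertex_degree G v))"
  by (simp add: sum_subtractf sum_vertex_degree)

lemma (in graph) deficiency_pos:
  assumes "irregular G"
  shows "0 < real (card (verts G)) * real (max_degree G) - 2 * real (card (edges G))"
proof -
  obtain v where v: "v \<in> verts G" "vertex_degree G v \<noteq> max_degree G"
    using assms unfolding irregular_def by metis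
  then have "0 < real (max_degree G) - real (vertex_degree G v)"
    using vertex_degree_le_max_degree[OF v(1)] by simp
  then show ?thesis
    unfolding deficiency_eq_sum using v(1) vertex_degree_le_max_degree
    by (intro sum_pos2[of _ v]) auto
qed

text \<open>The analytic core, for any \<open>x\<close> that is nonzero somewhere, with the
  denominator cleared. The eigenvalue equation and the factor \<open>1 - \<alpha>\<close> enter only
  later.\<close>

lemma (in graph) deficiency_form_lower_bound:
  fixes x :: "'a \<Rightarrow> real"
  assumes conn: "Digraph_Component.connected G" and irr: "irregular G"
    and nz: "w \<in> verts G" "x w \<noteq> 0"
  defines "n \<equiv> real (card (verts G))" and "\<Delta> \<equiv> real (max_degree G)"
  defines "c \<equiv> n * \<Delta> - 2 * real (card (edges G))"
  shows "c * (\<Sum>v\<in>verts G. (x v)\<^sup>2) < n * (real (diam G) * c + 1) *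
      ((\<Sum>v\<in>verts G. (\<Delta> - real (vertex_degree G v)) * (x v)\<^sup>2) + dirichlet_energy G x)"
proof -
  let ?V = "verts G" and ?def = "\<lambda>v. \<Delta> - real (vertex_degree G v)"
  let ?L = "{v \<in> verts G. vertex_degree G v \<noteq> max_degree G}"
  let ?D = "real (diam G)" and ?E = "dirichlet_energy G x"
  have c: "c = (\<Sum>v\<in>?V. ?def v)"
    unfolding c_def n_def \<Delta>_def by (rule deficiency_eq_sum)
  have def_nonneg: "0 \<le> ?def v" if "v \<in> ?V" for v
    using vertex_degree_le_max_degree[OF that] by (simp add: \<Delta>_def)
  have ne: "?V \<noteq> {}" using nz by auto
  have "?L \<noteq> {}" using irr unfolding irregular_def by force
  then obtain v where v: "v \<in> ?L" and vmin: "\<And>w. w \<in> ?L \<Longrightarrow> (x v)\<^sup>2 \<le> (x w)\<^sup>2"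
    using ex_is_arg_min_if_finite[of ?L "\<lambda>v. (x v)\<^sup>2"] by (auto simp: is_arg_min_linorder)
  obtain u where u: "u \<in> ?V" and umax: "\<And>w. w \<in> ?V \<Longrightarrow> (x w)\<^sup>2 \<le> (x u)\<^sup>2"
    using ex_is_arg_min_if_finite[OF finite_verts ne, of "\<lambda>v. - (x v)\<^sup>2"]
    by (auto simp: is_arg_min_linorder)
  have vV: "v \<in> ?V" using v by simp
  have c_pos: "0 < c" using deficiency_pos[OF irr] unfolding c_def n_def \<Delta>_def .
  have n_pos: "0 < n" unfolding n_def using ne by (simp add: card_gt_0_iff)
  have xu: "0 < (x u)\<^sup>2" using umax[OF nz(1)] nz(2) by (meson less_le_trans zero_less_power2)
  \<comment> \<open>With diameter 0 all shortest paths are empty, so there is only one vertex,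
    against irregularity.\<close>
  have D_pos: "0 < ?D"
  proof (rule ccontr)
    assume "\<not> 0 < ?D"
    then have "graph_dist G a b = 0" if "a \<in> ?V" "b \<in> ?V" for a b
      using graph_dist_le_diam[OF that] by simp
    then have "a = b" if "a \<in> ?V" "b \<in> ?V" for a b
      using that graph_dist_apath[OF conn that] by (metis apath_Nil_iff length_0_conv)
    then show False using irr unfolding irregular_def by metis
  qed
  have form: "c * (x v)\<^sup>2 \<le> (\<Sum>w\<in>?V. ?def w * (x w)\<^sup>2)"
    unfolding c sum_distrib_right
  proof (rule sum_mono)
    fix w assume w: "w \<in> ?V"
    show "?def w * (x v)\<^sup>2 \<le> ?def w * (x w)\<^sup>2"
    \<comment> \<open>Off \<open>?L\<close> the weight \<open>?def w\<close> vanishes, so minimality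
      of \<open>v\<close> within \<open>?L\<close> suffices.\<close>
    proof (cases "w \<in> ?L")
      case True
      then show ?thesis using vmin def_nonneg[OF w] by (intro mult_left_mono) auto
    next
      case False
      then show ?thesis using w by (simp add: \<Delta>_def)
    qed
  qed
  have pos: "0 < ?D * c + 1" using D_pos c_pos by (simp add: add_pos_pos)
  have tradeoff: "c * (x u)\<^sup>2 \<le> (?D * c + 1) * (c * (x v)\<^sup>2 + ?E)"
    using quadratic_tradeoff[OF c_pos D_pos diam_energy_bound[OF conn u vV]] .
  have sum_le: "(\<Sum>w\<in>?V. (x w)\<^sup>2) \<le> n * (x u)\<^sup>2"
    unfolding n_def using sum_bounded_above[of ?V "\<lambda>w. (x w)\<^sup>2"] umax by simp
  have "c * (\<Sum>w\<in>?V. (x w)\<^sup>2) < n * ((?D * c + 1) * (c * (x v)\<^sup>2 + ?E))"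
  proof (cases "(x v)\<^sup>2 < (x u)\<^sup>2")
    case True
    have "(\<Sum>w\<in>?V. (x w)\<^sup>2) < (\<Sum>w\<in>?V. (x u)\<^sup>2)"
      using True umax vV by (intro sum_strict_mono_ex1) auto
    then have "c * (\<Sum>w\<in>?V. (x w)\<^sup>2) < n * (c * (x u)\<^sup>2)"
      using c_pos by (simp add: n_def mult.left_commute)
    also have "\<dots> \<le> n * ((?D * c + 1) * (c * (x v)\<^sup>2 + ?E))"
      using tradeoff n_pos by simp
    finally show ?thesis .
  next
    case False
    then have eq: "(x v)\<^sup>2 = (x u)\<^sup>2" using umax[OF vV] by simp
    \<comment> \<open>This is the difference of the two sides of the next inequality. Its first
      summand makes it positive even if the energy is 0.\<close>
    have "0 < ?D * c * (c * (x u)\<^sup>2) + (?D * c + 1) * ?E"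
      using D_pos c_pos xu pos dirichlet_energy_nonneg[of G x]
      by (intro add_pos_nonneg mult_pos_pos mult_nonneg_nonneg) auto
    then have "c * (x u)\<^sup>2 < (?D * c + 1) * (c * (x v)\<^sup>2 + ?E)"
      unfolding eq by (simp add: algebra_simps)
    then have "n * (c * (x u)\<^sup>2) < n * ((?D * c + 1) * (c * (x v)\<^sup>2 + ?E))"
      using n_pos by simp
    moreover have "c * (\<Sum>w\<in>?V. (x w)\<^sup>2) \<le> n * (c * (x u)\<^sup>2)"
      using sum_le c_pos by (simp add: mult.left_commute)
    ultimately show ?thesis by linarith
  qed
  also have "\<dots> \<le> n * ((?D * c + 1) * ((\<Sum>w\<in>?V. ?def w * (x w)\<^sup>2) + ?E))"
    using form n_pos pos by simp
  finally show "c * (\<Sum>v\<in>?V. (x v)\<^sup>2) < n * (?D * c + 1) * ((\<Sum>v\<in>?V. ?def v * (x v)\<^sup>2) + ?E)"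
    by (simp add: mult.assoc)
qed

section \<open>The spectral bound\<close>

lemma A_alpha_carrier: "A_alpha \<alpha> G vs \<in> carrier_mat (length vs) (length vs)"
  unfolding A_alpha_def degree_mat_def adjacency_mat_def by simp

lemma A_alpha_index:
  assumes "i < length vs" "j < length vs"
  shows "A_alpha \<alpha> G vs $$ (i, j) =
    \<alpha> * (if i = j then real (vertex_degree G (vs ! i)) else 0)
    + (1 - \<alpha>) * (if vs ! i \<rightarrow>\<^bsub>G\<^esub> vs ! j then 1 else 0)"
  using assms unfolding A_alpha_def degree_mat_def adjacency_mat_def by simp

text \<open>The labelling is a bijection from indices to vertices, so an eigenvector becomes a
  function on vertices and \<open>vs\<close> disappears from the equation.\<close>

lemma (in graph) A_alpha_eigenfunction:
  assumes lab: "vertex_labelling G vs" and ev: "eigenvalue (A_alpha \<alpha> G vs) k"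
  obtains x w where "w \<in> verts G" "x w \<noteq> 0"
    "\<And>u. u \<in> verts G \<Longrightarrow> k * x u = \<alpha> * real (vertex_degree G u) * x u
      + (1 - \<alpha>) * (\<Sum>v\<in>verts G. if u \<rightarrow>\<^bsub>G\<^esub> v then x v else 0)"
proof -
  let ?n = "length vs" and ?A = "A_alpha \<alpha> G vs"
  obtain y where y: "y \<in> carrier_vec ?n" "y \<noteq> 0\<^sub>v ?n" and eq: "?A *\<^sub>v y = k \<cdot>\<^sub>v y"
    using ev A_alpha_carrier[of \<alpha> G vs] unfolding eigenvalue_def eigenvector_def by auto
  have bij: "bij_betw ((!) vs) {..<?n} (verts G)"
    using lab unfolding vertex_labelling_def by (simp add: bij_betw_nth)
  define x where "x u = y $ (the_inv_into {..<?n} ((!) vs) u)" for u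
  have x: "x (vs ! i) = y $ i" if "i < ?n" for i
    using that bij by (simp add: x_def the_inv_into_f_f bij_betw_def)
  obtain i where i: "i < ?n" "y $ i \<noteq> 0"
    using y by (metis carrier_vecD eq_vecI index_zero_vec(1) index_zero_vec(2))
  show ?thesis
  proof (rule that)
    show "vs ! i \<in> verts G" using i(1) bij by (auto simp: bij_betw_def)
    show "x (vs ! i) \<noteq> 0" using i x by simp
    fix u assume "u \<in> verts G"
    then obtain l where l: "l < ?n" "u = vs ! l" using bij by (auto simp: bij_betw_def)
    have "k * x u = (?A *\<^sub>v y) $ l" using eq l x y by simp
    also have "\<dots> = (\<Sum>j<?n. ?A $$ (l, j) * y $ j)"
      using l y A_alpha_carrier[of \<alpha> G vs] by (simp add: scalar_prod_def atLeast0LessThan)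
    also have "\<dots> = (\<Sum>j<?n. (if l = j then \<alpha> * real (vertex_degree G u) * x u else 0)
        + (1 - \<alpha>) * (if u \<rightarrow>\<^bsub>G\<^esub> vs ! j then x (vs ! j) else 0))"
      using l x by (intro sum.cong) (auto simp: A_alpha_index algebra_simps)
    also have "\<dots> = \<alpha> * real (vertex_degree G u) * x u
        + (1 - \<alpha>) * (\<Sum>j<?n. if u \<rightarrow>\<^bsub>G\<^esub> vs ! j then x (vs ! j) else 0)"
      using l by (simp add: sum.distrib sum_distrib_left)
    also have "(\<Sum>j<?n. if u \<rightarrow>\<^bsub>G\<^esub> vs ! j then x (vs ! j) else 0)
        = (\<Sum>v\<in>verts G. if u \<rightarrow>\<^bsub>G\<^esub> v then x v else 0)"
      by (rule sum.reindex_bij_betw[OF bij])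
    finally show "k * x u = \<alpha> * real (vertex_degree G u) * x u
        + (1 - \<alpha>) * (\<Sum>v\<in>verts G. if u \<rightarrow>\<^bsub>G\<^esub> v then x v else 0)" .
  qed
qed

text \<open>\<open>A_alpha\<close> is the degree matrix minus \<open>1 - \<alpha>\<close> times the
  Laplacian. The eigenvalue equation is multiplied by \<open>x u\<close> and summed;
  \<open>d\<close> will be the maximum degree.\<close>

lemma (in graph) A_alpha_eigenfunction_energy:
  assumes "\<And>u. u \<in> verts G \<Longrightarrow> k * x u = \<alpha> * real (vertex_degree G u) * x u
      + (1 - \<alpha>) * (\<Sum>v\<in>verts G. if u \<rightarrow>\<^bsub>G\<^esub> v then x v else 0)"
  shows "(d - k) * (\<Sum>v\<in>verts G. (x v)\<^sup>2) =
    (\<Sum>v\<in>verts G. (d - real (vertex_degree G v)) * (x v)\<^sup>2) + (1 - \<alpha>) * dirichlet_energy G x"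
proof -
  let ?deg = "\<lambda>v. real (vertex_degree G v)"
  have "k * (\<Sum>u\<in>verts G. (x u)\<^sup>2) = (\<Sum>u\<in>verts G. x u * (k * x u))"
    by (simp add: sum_distrib_left power2_eq_square ac_simps)
  also have "\<dots> = (\<Sum>u\<in>verts G. \<alpha> * (?deg u * (x u)\<^sup>2)
      + (1 - \<alpha>) * (\<Sum>v\<in>verts G. if u \<rightarrow>\<^bsub>G\<^esub> v then x u * x v else 0))"
  proof (rule sum.cong[OF refl])
    fix u assume u: "u \<in> verts G"
    have "x u * (\<Sum>v\<in>verts G. if u \<rightarrow>\<^bsub>G\<^esub> v then x v else 0)
        = (\<Sum>v\<in>verts G. if u \<rightarrow>\<^bsub>G\<^esub> v then x u * x v else 0)"
      by (simp add: sum_distrib_left if_distrib cong: if_cong)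
    then show "x u * (k * x u) = \<alpha> * (?deg u * (x u)\<^sup>2)
        + (1 - \<alpha>) * (\<Sum>v\<in>verts G. if u \<rightarrow>\<^bsub>G\<^esub> v then x u * x v else 0)"
      unfolding assms[OF u] by (simp add: distrib_left power2_eq_square mult.left_commute)
  qed
  also have "\<dots> = \<alpha> * (\<Sum>u\<in>verts G. ?deg u * (x u)\<^sup>2)
      + (1 - \<alpha>) * (\<Sum>e\<in>arcs G. x (tail G e) * x (head G e))"
    by (simp add: sum.distrib sum_distrib_left sum_arcs_eq_sum_adjacent[of "\<lambda>u v. x u * x v"])
  finally have "k * (\<Sum>u\<in>verts G. (x u)\<^sup>2) =
      (\<Sum>u\<in>verts G. ?deg u * (x u)\<^sup>2) - (1 - \<alpha>) * dirichlet_energy G x"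
    unfolding dirichlet_energy_eq by (simp add: algebra_simps)
  then show ?thesis
    by (simp add: left_diff_distrib sum_subtractf sum_distrib_left)
qed

theorem theorem3p1:
  fixes G :: "('a, 'b) pre_digraph" and vs :: "'a list"
    and n m \<Delta> :: nat and \<alpha> :: real
  assumes "graph G" and "Digraph_Component.connected G" and "irregular G"
    and "vertex_labelling G vs"
    and "n = card (verts G)" and "m = card (edges G)" and "\<Delta> = max_degree G"
    and "0 \<le> \<alpha>" and "\<alpha> < 1"
  shows "nth_eigenvalue 1 (A_alpha \<alpha> G vs)
    < real \<Delta> - (1 - \<alpha>) * ((real n * real \<Delta> - 2 * real m)
        / (real n * (real (diam G) * (real n * real \<Delta> - 2 * real m) + 1)))"
proof -
  interpret graph G by fact
  let ?A = "A_alpha \<alpha> G vs" and ?V = "verts G"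
  define k where "k = nth_eigenvalue 1 ?A"
  have set_vs: "set vs = ?V" using assms(4) by (simp add: vertex_labelling_def)
  have len: "length vs > 0" using assms(3) set_vs unfolding irregular_def by auto
  have sym: "?A $$ (i, j) = ?A $$ (j, i)" if "i < length vs" "j < length vs" for i j
  proof -
    have "vs ! i \<rightarrow>\<^bsub>G\<^esub> vs ! j \<longleftrightarrow> vs ! j \<rightarrow>\<^bsub>G\<^esub> vs ! i"
      by (meson sym_arcs symmetric_def symD)
    then show ?thesis using that by (simp add: A_alpha_index)
  qed
  obtain k' where "eigenvalue ?A k'"
    using symmetric_mat_eigenvalue_exists[OF A_alpha_carrier len sym] by auto
  then have "eigenvalue ?A k"
    unfolding k_def by (rule eigenvalue_nth_eigenvalue_1[OF A_alpha_carrier])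
  then obtain x w where w: "w \<in> ?V" "x w \<noteq> 0"
    and eq: "\<And>u. u \<in> ?V \<Longrightarrow> k * x u = \<alpha> * real (vertex_degree G u) * x u
      + (1 - \<alpha>) * (\<Sum>v\<in>?V. if u \<rightarrow>\<^bsub>G\<^esub> v then x v else 0)"
    by (rule A_alpha_eigenfunction[OF assms(4)]) (rule that)
  define c where "c = real n * real \<Delta> - 2 * real m"
  define N where "N = (\<Sum>v\<in>?V. (x v)\<^sup>2)"
  define Q where "Q = (\<Sum>v\<in>?V. (real \<Delta> - real (vertex_degree G v)) * (x v)\<^sup>2)"
  define E where "E = dirichlet_energy G x"
  define P where "P = real n * (real (diam G) * c + 1)"
  have c_pos: "0 < c"
    using deficiency_pos[OF assms(3)] unfolding c_def assms(5-7) .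
  have bound: "c * N < P * (Q + E)"
    using deficiency_form_lower_bound[where x = x, OF assms(2,3) w]
    unfolding c_def N_def Q_def E_def P_def assms(5-7) .
  have N_pos: "0 < N" unfolding N_def using w by (intro sum_pos2[of _ w]) auto
  have "0 < card ?V" using w by (auto simp: card_gt_0_iff)
  then have P_pos: "0 < P" unfolding P_def using c_pos assms(5) by (simp add: add_nonneg_pos)
  have "0 \<le> Q" unfolding Q_def assms(7)
    using vertex_degree_le_max_degree by (intro sum_nonneg) auto
  \<comment> \<open>The identity weights only \<open>E\<close> by \<open>1 - \<alpha>\<close>,
    whereas the bound concerns \<open>Q + E\<close>; since \<open>Q\<close> is nonnegative, the
    factor may be put on \<open>Q\<close> as well.\<close>
  then have "(1 - \<alpha>) * Q \<le> Q" using assms(8,9) by (simp add: mult_left_le_one_le)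
  have "(1 - \<alpha>) * (c / P) * N = (1 - \<alpha>) * (c * N / P)" by simp
  \<comment> \<open>Strictness survives the multiplication because
    \<open>\<alpha> < 1\<close>.\<close>
  also have "\<dots> < (1 - \<alpha>) * (Q + E)"
    using bound P_pos assms(9) by (simp add: pos_divide_less_eq mult.commute)
  also have "\<dots> \<le> Q + (1 - \<alpha>) * E"
    using \<open>(1 - \<alpha>) * Q \<le> Q\<close> by (simp add: distrib_left)
  also have "\<dots> = (real \<Delta> - k) * N"
    using A_alpha_eigenfunction_energy[OF eq, of "real \<Delta>"] unfolding N_def Q_def E_def by simp
  finally have "(1 - \<alpha>) * (c / P) < real \<Delta> - k" using N_pos by (simp only: mult_less_cancel_right_pos)
  then show ?thesis unfolding k_def P_def c_def by simp
qed

end
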